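(* For $n\ge 1$ let $\mathbf{C}_n\subset\mathbb{R}^n$ be the Cayley polytope $$\mathbf{C}_n=\{(x_1,\dots,x_n)\in\mathbb{R}^n:\ 1\le x_1\le 2,\ \ 1\le x_i\le 2x_{i-1}\text{ for } i=2,\dots,n\}.$$ Then $\operatorname{vol}\mathbf{C}_n = C_{n+1}/n!$, where $C_{n+1}$ is the number of connected labeled graphs on $n+1$ nodes.
   Context: A labeled graph on $N$ nodes is a simple graph on the node set $\{1,\dots,N\}$; $C_N$ denotes the number of connected labeled graphs on $N$ nodes. Volume is $n$-dimensional Lebesgue measure. *)

theory Defs
  imports "HOL-Analysis.Analysis" "Graph_Theory.Digraph_Component"
begin

text \<open>
  Points of \<open>\<real>\<^sup>n\<close> are functions on \<open>{1..n}\<close>, extended by \<open>undefined\<close> elsewhere, as in the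
  space of the product measure \<open>\<Pi>\<^sub>M i\<in>{1..n}. lborel\<close>, which is Lebesgue measure on \<open>\<real>\<^sup>n\<close>.
\<close>

definition cayley_polytope :: "nat \<Rightarrow> (nat \<Rightarrow> real) set" where
  "cayley_polytope n =
     {x \<in> {1..n} \<rightarrow>\<^sub>E UNIV. 1 \<le> x 1 \<and> x 1 \<le> 2 \<and> (\<forall>i\<in>{2..n}. 1 \<le> x i \<and> x i \<le> 2 * x (i - 1))}"

text \<open>
  A \<open>pair_graph\<close> is a finite loop-free digraph without parallel arcs whose arc set is symmetric;
  an undirected edge between \<open>u\<close> and \<open>v\<close> is the pair of arcs \<open>(u, v)\<close>, \<open>(v, u)\<close>. So simple graphs
  on a finite vertex set correspond one-to-one to the \<open>pair_graph\<close>s on it. The name \<open>connected\<close>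
  is qualified because of topological connectedness.
\<close>

definition connected_labeled_graphs :: "nat \<Rightarrow> nat pair_pre_digraph set" where
  "connected_labeled_graphs N =
     {G. pair_graph G \<and> pverts G = {1..N} \<and> Digraph_Component.connected (with_proj G)}"

definition num_connected_labeled_graphs :: "nat \<Rightarrow> nat" where
  "num_connected_labeled_graphs N = card (connected_labeled_graphs N)"

end

theory Submission
  imports Defs
begin

text \<open>
  Let \<open>G(z) = \<Sum>k. 2 ^ (k choose 2) z ^ k / k!\<close>, so that \<open>G'(z) = G(2z)\<close>. Let \<open>f\<^sub>n(t)\<close> be the volume of
  the polytope \<open>1 \<le> x\<^sub>1 \<le> 2t\<close>, \<open>1 \<le> x\<^sub>i \<le> 2x\<^sub>i\<^sub>-\<^sub>1\<close>. Integrating over \<open>x\<^sub>1\<close> last gives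
  \<open>f\<^sub>n\<^sub>+\<^sub>1(t) = \<integral> f\<^sub>n\<close> over \<open>[1, 2t]\<close>, whose solution is the coefficient of \<open>z ^ n\<close> in \<open>G(2tz) / G(z)\<close>.
  Splitting an arbitrary graph on \<open>n + 1\<close> nodes into the component of a root and the rest shows that
  \<open>G(2z) / G(z)\<close> is also the series with coefficients \<open>C\<^sub>n\<^sub>+\<^sub>1 / n!\<close>.
\<close>

section \<open>The volume as a coefficient of a quotient of power series\<close>

definition graph_egf :: "real fps" where
  "graph_egf = Abs_fps (\<lambda>k. 2 ^ (k choose 2) / fact k)"

text \<open>The coefficient of \<open>z^n\<close> in \<open>G(2tz) / G(z)\<close>, written out as a
  polynomial in \<open>t\<close> so that it can be differentiated in \<open>t\<close>.\<close>

definition chain_volume :: "nat \<Rightarrow> real \<Rightarrow> real" where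
  "chain_volume n t =
     (\<Sum>j\<le>n. fps_nth graph_egf j * (2 * t) ^ j * fps_nth (inverse graph_egf) (n - j))"

text \<open>The coefficientwise form of \<open>G'(z) = G(2z)\<close>; it rests on
  \<open>Suc j choose 2 = j + (j choose 2)\<close>.\<close>

lemma graph_egf_nth_Suc:
  "real (Suc j) * fps_nth graph_egf (Suc j) = 2 ^ j * fps_nth graph_egf j"
proof -
  have "Suc j choose 2 = j + (j choose 2)"
    by (simp add: numeral_2_eq_2)
  then show ?thesis
    by (simp add: graph_egf_def power_add divide_simps del: of_nat_Suc)
qed

lemma graph_egf_nth_0: "fps_nth graph_egf 0 = 1"
  by (simp add: graph_egf_def binomial_eq_0)

lemma graph_egf_inverse: "graph_egf * inverse graph_egf = 1"
  by (rule inverse_mult_eq_1') (simp add: graph_egf_nth_0)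

lemma chain_volume_0: "chain_volume 0 t = 1"
  by (simp add: chain_volume_def graph_egf_nth_0)

text \<open>At \<open>t = 1/2\<close> the quotient \<open>G(2tz) / G(z)\<close> is 1. Geometrically
  the range \<open>[1, 2t]\<close> of the first coordinate shrinks to a point; this is the initial
  value for the integral recursion.\<close>

lemma chain_volume_half: "chain_volume (Suc k) (1 / 2) = 0"
proof -
  have "chain_volume (Suc k) (1 / 2) = fps_nth (graph_egf * inverse graph_egf) (Suc k)"
    by (simp add: chain_volume_def fps_mult_nth atLeast0AtMost)
  then show ?thesis
    by (simp add: graph_egf_inverse)
qed

text \<open>The identity \<open>(G(2z) / G(z)) G(z) = G(2z)\<close>, kept in multiplied-out form so
  that it can be compared with \<open>connected_egf\<close>.\<close>

lemma chain_volume_one: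
  "fps_nth (Abs_fps (\<lambda>k. chain_volume k 1) * graph_egf) n = 2 ^ n * fps_nth graph_egf n"
proof -
  have "Abs_fps (\<lambda>k. chain_volume k 1)
      = Abs_fps (\<lambda>j. 2 ^ j * fps_nth graph_egf j) * inverse graph_egf"
    by (rule fps_ext) (simp add: chain_volume_def fps_mult_nth atLeast0AtMost mult.commute[of "fps_nth graph_egf _"])
  then have "Abs_fps (\<lambda>k. chain_volume k 1) * graph_egf
      = Abs_fps (\<lambda>j. 2 ^ j * fps_nth graph_egf j) * (graph_egf * inverse graph_egf)"
    by (simp only: mult_ac)
  then have "Abs_fps (\<lambda>k. chain_volume k 1) * graph_egf = Abs_fps (\<lambda>j. 2 ^ j * fps_nth graph_egf j)"
    by (simp only: graph_egf_inverse mult_1_right)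
  then show ?thesis by simp
qed

text \<open>Differentiating \<open>G(xz) / G(z)\<close> in \<open>x\<close> gives
  \<open>z G'(xz) / G(z) = z G(2xz) / G(z)\<close>, and the factor \<open>z\<close> lowers the index
  by one. The argument \<open>x / 2\<close> makes the upper limit \<open>2t\<close> of the integral
  the variable.\<close>

lemma chain_volume_deriv:
  "((\<lambda>x. chain_volume (Suc k) (x / 2)) has_real_derivative chain_volume k x) (at x)"
proof -
  let ?h = "fps_nth (inverse graph_egf)"
  have "((\<lambda>x. \<Sum>j\<le>Suc k. fps_nth graph_egf j * x ^ j * ?h (Suc k - j)) has_real_derivative
      (\<Sum>j\<le>Suc k. fps_nth graph_egf j * (real j * x ^ (j - 1)) * ?h (Suc k - j))) (at x)"
    by (rule DERIV_sum) (auto intro!: derivative_eq_intros)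
  also have "(\<Sum>j\<le>Suc k. fps_nth graph_egf j * (real j * x ^ (j - 1)) * ?h (Suc k - j))
      = (\<Sum>j\<le>k. (real (Suc j) * fps_nth graph_egf (Suc j)) * x ^ j * ?h (k - j))"
    \<comment> \<open>The term \<open>j = 0\<close> vanishes because of the factor
      \<open>real j\<close>.\<close>
    unfolding sum.atMost_Suc_shift by (simp add: mult_ac del: of_nat_Suc sum.atMost_Suc)
  also have "\<dots> = chain_volume k x"
    unfolding graph_egf_nth_Suc chain_volume_def by (simp add: power_mult_distrib mult_ac)
  finally show ?thesis by (simp add: chain_volume_def)
qed

text \<open>The value is 0 at \<open>t = 1/2\<close> for positive index, and the derivative is the
  previous polynomial at some \<open>x \<ge> 1\<close>, nonnegative by induction. Without the sign,
  \<open>ennreal\<close> could truncate the value to 0.\<close>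

lemma chain_volume_nonneg: "1 / 2 \<le> t \<Longrightarrow> 0 \<le> chain_volume n t"
proof (induction n arbitrary: t)
  case 0
  then show ?case by (simp add: chain_volume_0)
next
  case (Suc n)
  have "chain_volume (Suc n) (1 / 2) \<le> chain_volume (Suc n) (2 * t / 2)"
  proof (rule DERIV_nonneg_imp_nondecreasing[where f = "\<lambda>x. chain_volume (Suc n) (x / 2)"])
    show "1 \<le> 2 * t" using Suc.prems by simp
    fix x :: real assume "1 \<le> x"
    then show "\<exists>y. ((\<lambda>x. chain_volume (Suc n) (x / 2)) has_real_derivative y) (at x) \<and> 0 \<le> y"
      using Suc.IH[of x] chain_volume_deriv by auto
  qed
  then show ?case by (simp add: chain_volume_half)
qed

section \<open>Volumes of chain polytopes by iterated integration\<close>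

text \<open>The parameter \<open>t\<close> stands in for the coordinate before the first one. The
  free starting index \<open>m\<close> lets the first coordinate be removed without renumbering the
  others.\<close>

definition chain_polytope :: "nat \<Rightarrow> nat \<Rightarrow> real \<Rightarrow> (nat \<Rightarrow> real) set" where
  "chain_polytope m k t = {x \<in> {m..<m + k} \<rightarrow>\<^sub>E UNIV.
     \<forall>i\<in>{m..<m + k}. 1 \<le> x i \<and> x i \<le> 2 * (if i = m then t else x (i - 1))}"

lemma sets_chain_polytope:
  "chain_polytope m k t \<in> sets (\<Pi>\<^sub>M i\<in>{m..<m + k}. lborel)"
proof -
  let ?M = "\<Pi>\<^sub>M i\<in>{m..<m + k}. (lborel :: real measure)"
  have "{x \<in> space ?M. 1 \<le> x i \<and> x i \<le> 2 * (if i = m then t else x (i - 1))} \<in> sets ?M"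
    if i: "i \<in> {m..<m + k}" for i
  proof -
    have coord: "(\<lambda>x. x j) \<in> borel_measurable ?M" if "j \<in> {m..<m + k}" for j
      using measurable_component_singleton[OF that, of "\<lambda>_. lborel :: real measure"]
      by (simp cong: measurable_cong_sets)
    have "(\<lambda>x. if i = m then t else x (i - 1)) \<in> borel_measurable ?M"
    proof (cases "i = m")
      case False
      then have "i - 1 \<in> {m..<m + k}" using i by auto
      from coord[OF this] False show ?thesis by simp
    qed simp
    then have "(\<lambda>x. 2 * (if i = m then t else x (i - 1))) \<in> borel_measurable ?M"
      by (intro borel_measurable_times borel_measurable_const)
    then show ?thesis
      using coord[OF i] by (intro sets.sets_Collect_conj borel_measurable_le) auto
  qed
  then have "{x \<in> space ?M. \<forall>i\<in>{m..<m + k}. 1 \<le> x i \<and> x i \<le> 2 * (if i = m then t else x (i - 1))}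
      \<in> sets ?M"
    by (intro sets.sets_Collect_finite_All) auto
  then show ?thesis
    by (simp add: chain_polytope_def space_PiM)
qed

text \<open>The slice at first coordinate \<open>y\<close> is again a chain polytope, with
  \<open>y\<close> in the role of \<open>t\<close>; this is what Fubini needs.\<close>

lemma chain_polytope_Suc:
  assumes "x \<in> {Suc m..<Suc m + k} \<rightarrow>\<^sub>E UNIV"
  shows "x(m := y) \<in> chain_polytope m (Suc k) t \<longleftrightarrow>
    y \<in> {1..2 * t} \<and> x \<in> chain_polytope (Suc m) k y"
proof -
  have "{m..<m + Suc k} = insert m {Suc m..<Suc m + k}"
    by auto
  moreover have "x(m := y) \<in> {m..<m + Suc k} \<rightarrow>\<^sub>E UNIV"
    using assms by (auto simp: PiE_def extensional_def)
  moreover have "(x(m := y)) (i - 1) = (if i = Suc m then y else x (i - 1))"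
    if "i \<in> {Suc m..<Suc m + k}" for i
    using that by auto
  ultimately show ?thesis
    using assms by (auto simp: chain_polytope_def)
qed

lemma emeasure_chain_polytope:
  "1 / 2 \<le> t \<Longrightarrow>
    emeasure (\<Pi>\<^sub>M i\<in>{m..<m + k}. lborel) (chain_polytope m k t) = ennreal (chain_volume k t)"
proof (induction k arbitrary: m t)
  case 0
  have "chain_polytope m 0 t = {\<lambda>_. undefined}"
    by (simp add: chain_polytope_def)
  then show ?case by (simp add: chain_volume_0)
next
  case (Suc k)
  interpret product_sigma_finite "\<lambda>_. lborel :: real measure"
    by standard
  let ?M = "\<lambda>I. \<Pi>\<^sub>M i\<in>I. (lborel :: real measure)"
  let ?I = "{Suc m..<Suc m + k}"
  have I: "{m..<m + Suc k} = insert m ?I" by auto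
  have meas: "(indicator (chain_polytope m (Suc k) t) :: _ \<Rightarrow> ennreal)
      \<in> borel_measurable (?M (insert m ?I))"
    using sets_chain_polytope[of m "Suc k" t] unfolding I by simp
  have "emeasure (?M {m..<m + Suc k}) (chain_polytope m (Suc k) t)
      = (\<integral>\<^sup>+x. indicator (chain_polytope m (Suc k) t) x \<partial>?M (insert m ?I))"
    using sets_chain_polytope[of m "Suc k" t] unfolding I by simp
  \<comment> \<open>The first coordinate is integrated last, since its value \<open>y\<close> is the
    parameter of the inner polytope.\<close>
  also have "\<dots> = (\<integral>\<^sup>+y. \<integral>\<^sup>+x. indicator (chain_polytope m (Suc k) t) (x(m := y)) \<partial>?M ?I \<partial>lborel)"
    by (rule product_nn_integral_insert_rev[OF _ _ meas]) auto
  also have "\<dots> = (\<integral>\<^sup>+y. ennreal (chain_volume k y) * indicator {1..2 * t} y \<partial>lborel)"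
  proof (rule nn_integral_cong)
    fix y :: real
    have "(\<integral>\<^sup>+x. indicator (chain_polytope m (Suc k) t) (x(m := y)) \<partial>?M ?I)
        = (\<integral>\<^sup>+x. indicator {1..2 * t} y * indicator (chain_polytope (Suc m) k y) x \<partial>?M ?I)"
    proof (rule nn_integral_cong)
      fix x assume "x \<in> space (?M ?I)"
      then have "x \<in> ?I \<rightarrow>\<^sub>E UNIV" by (simp add: space_PiM)
      from chain_polytope_Suc[OF this, of y t]
      show "indicator (chain_polytope m (Suc k) t) (x(m := y))
          = (indicator {1..2 * t} y * indicator (chain_polytope (Suc m) k y) x :: ennreal)"
        by (simp add: indicator_def)
    qed
    also have "\<dots> = indicator {1..2 * t} y * emeasure (?M ?I) (chain_polytope (Suc m) k y)"
      using sets_chain_polytope[of "Suc m" k y] by (subst nn_integral_cmult) auto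
    also have "\<dots> = ennreal (chain_volume k y) * indicator {1..2 * t} y"
      \<comment> \<open>Where the indicator is nonzero, \<open>y \<ge> 1\<close>, so the induction
        hypothesis applies.\<close>
      using Suc.IH[of y "Suc m"] by (auto simp: indicator_def)
    finally show "(\<integral>\<^sup>+x. indicator (chain_polytope m (Suc k) t) (x(m := y)) \<partial>?M ?I)
        = ennreal (chain_volume k y) * indicator {1..2 * t} y" .
  qed
  also have "\<dots> = ennreal (chain_volume (Suc k) (2 * t / 2) - chain_volume (Suc k) (1 / 2))"
  proof (rule nn_integral_FTC_Icc[where F = "\<lambda>x. chain_volume (Suc k) (x / 2)"])
    show "chain_volume k \<in> borel_measurable borel"
      unfolding chain_volume_def by measurable
  qed (use Suc.prems chain_volume_deriv chain_volume_nonneg in auto)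
  also have "\<dots> = ennreal (chain_volume (Suc k) t)"
    by (simp add: chain_volume_half)
  finally show ?case .
qed

lemma measure_cayley_polytope:
  assumes "n \<ge> 1"
  shows "measure (\<Pi>\<^sub>M i\<in>{1..n}. lborel) (cayley_polytope n) = chain_volume n 1"
proof -
  have I: "{1..n} = {1..<1 + n}" by auto
  have "{1..<1 + n} = insert 1 {2..n}"
    using assms by auto
  then have "cayley_polytope n = chain_polytope 1 n 1"
    unfolding cayley_polytope_def chain_polytope_def I by auto
  then show ?thesis
    using emeasure_chain_polytope[of 1 1 n] chain_volume_nonneg[of 1 n]
    unfolding I measure_def by simp
qed

section \<open>Counting graphs by the component of a root\<close>

text \<open>Simple graphs on \<open>V\<close> as bare relations: connectivity becomes reflexive
  transitive closure, and disjoint union of graphs becomes union of sets.\<close>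

definition sym_irrefl_rels :: "'a set \<Rightarrow> 'a rel set" where
  "sym_irrefl_rels V = {R. R \<subseteq> V \<times> V \<and> sym R \<and> irrefl R}"

definition connected_rels :: "'a set \<Rightarrow> 'a rel set" where
  "connected_rels V = {R \<in> sym_irrefl_rels V. \<forall>u\<in>V. \<forall>v\<in>V. (u, v) \<in> R\<^sup>*}"

lemma finite_sym_irrefl_rels: "finite V \<Longrightarrow> finite (sym_irrefl_rels V)"
  by (rule finite_subset[of _ "Pow (V \<times> V)"]) (auto simp: sym_irrefl_rels_def)

lemma finite_connected_rels: "finite V \<Longrightarrow> finite (connected_rels V)"
  by (rule finite_subset[OF _ finite_sym_irrefl_rels]) (auto simp: connected_rels_def)

text \<open>Such relations correspond to arbitrary sets of two-element subsets of
  \<open>V\<close>.\<close>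

lemma card_sym_irrefl_rels:
  assumes "finite V"
  shows "card (sym_irrefl_rels V) = 2 ^ (card V choose 2)"
proof -
  let ?E = "{e. e \<subseteq> V \<and> card e = 2}"
  let ?rel = "\<lambda>F. {(u, v). u \<noteq> v \<and> {u, v} \<in> F}"
  have "bij_betw ?rel (Pow ?E) (sym_irrefl_rels V)"
  proof (rule bij_betw_byWitness[where f' = "\<lambda>R. {{u, v} | u v. (u, v) \<in> R}"])
    show "\<forall>F\<in>Pow ?E. {{u, v} | u v. (u, v) \<in> ?rel F} = F"
    proof
      fix F assume F: "F \<in> Pow ?E"
      have "e \<in> {{u, v} | u v. (u, v) \<in> ?rel F}" if "e \<in> F" for e
      proof -
        have "card e = 2" using F that by auto
        then obtain u v where "e = {u, v}" "u \<noteq> v" by (auto simp: card_2_iff)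
        then show ?thesis using that by auto
      qed
      then show "{{u, v} | u v. (u, v) \<in> ?rel F} = F" by auto
    qed
    show "\<forall>R\<in>sym_irrefl_rels V. ?rel {{u, v} | u v. (u, v) \<in> R} = R"
      by (auto simp: sym_irrefl_rels_def doubleton_eq_iff irrefl_def dest: symD)
    show "?rel ` Pow ?E \<subseteq> sym_irrefl_rels V"
      by (auto simp: sym_irrefl_rels_def irrefl_def sym_def insert_commute)
    show "(\<lambda>R. {{u, v} | u v. (u, v) \<in> R}) ` sym_irrefl_rels V \<subseteq> Pow ?E"
      by (auto simp: sym_irrefl_rels_def irrefl_def card_2_iff) metis
  qed
  then have "card (sym_irrefl_rels V) = card (Pow ?E)"
    by (rule bij_betw_same_card[symmetric])
  also have "\<dots> = 2 ^ (card V choose 2)"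
    using assms by (simp add: card_Pow n_subsets)
  finally show ?thesis .
qed

text \<open>Relabeling nodes along an injection preserves connectedness and is injective on graphs.
  Using it for a bijection and its inverse gives equality.\<close>

lemma card_connected_rels_le:
  assumes "finite V" and inj: "inj_on f V"
  shows "card (connected_rels V) \<le> card (connected_rels (f ` V))"
proof (rule card_inj_on_le)
  let ?g = "\<lambda>R. map_prod f f ` R"
  have "inj_on ?g (Pow (V \<times> V))"
    by (intro inj_on_image_Pow map_prod_inj_on inj)
  then show "inj_on ?g (connected_rels V)"
    by (rule inj_on_subset) (auto simp: connected_rels_def sym_irrefl_rels_def)
  show "finite (connected_rels (f ` V))"
    using assms by (simp add: finite_connected_rels)
  show "?g ` connected_rels V \<subseteq> connected_rels (f ` V)"
  proof
    fix R' assume "R' \<in> ?g ` connected_rels V"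
    then obtain R where R: "R \<in> connected_rels V" and R': "R' = ?g R" by auto
    have "(f u, f v) \<in> R'\<^sup>*" if "(u, v) \<in> R\<^sup>*" for u v
      using that
    proof induction
      case (step y z)
      then have "(f y, f z) \<in> R'" by (force simp: R')
      with step show ?case by auto
    qed auto
    moreover have "irrefl R'"
      using R inj by (auto simp: R' connected_rels_def sym_irrefl_rels_def irrefl_def inj_on_def)
    moreover have "sym R'"
      using R by (force simp: R' connected_rels_def sym_irrefl_rels_def sym_def)
    moreover have "R' \<subseteq> f ` V \<times> f ` V"
      using R by (auto simp: R' connected_rels_def sym_irrefl_rels_def)
    ultimately show "R' \<in> connected_rels (f ` V)"
      using R by (auto simp: connected_rels_def sym_irrefl_rels_def)
  qed
qed

lemma card_connected_rels_cong:
  assumes "finite V" "finite W" "card V = card W"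
  shows "card (connected_rels V) = card (connected_rels W)"
proof -
  obtain f where f: "bij_betw f V W"
    using assms finite_same_card_bij by blast
  have "card (connected_rels V) \<le> card (connected_rels W)"
    using card_connected_rels_le[OF assms(1), of f] f by (simp add: bij_betw_def)
  moreover have "card (connected_rels W) \<le> card (connected_rels V)"
    using card_connected_rels_le[OF assms(2), of "inv_into V f"] bij_betw_inv_into[OF f]
    by (simp add: bij_betw_def)
  ultimately show ?thesis by simp
qed

section \<open>Decomposition of a graph at the component of a root\<close>

text \<open>No edge of \<open>A\<close> or \<open>B\<close> leaves \<open>S\<close>, so
  \<open>S\<close> can be recovered from the union. This makes the classes for different
  \<open>S\<close> disjoint.\<close>

lemma component_of_union:
  assumes A: "A \<in> connected_rels S" and B: "B \<in> sym_irrefl_rels (V - S)" and "r \<in> S"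
  shows "(A \<union> B)\<^sup>* `` {r} = S"
proof
  show "S \<subseteq> (A \<union> B)\<^sup>* `` {r}"
    using A \<open>r \<in> S\<close> rtrancl_mono[of A "A \<union> B"] by (auto simp: connected_rels_def)
  have "v \<in> S" if "(r, v) \<in> (A \<union> B)\<^sup>*" for v
    using that
    by induction (use A B \<open>r \<in> S\<close> in \<open>auto simp: connected_rels_def sym_irrefl_rels_def\<close>)
  then show "(A \<union> B)\<^sup>* `` {r} \<subseteq> S" by auto
qed

lemma split_off_component:
  assumes G: "G \<in> sym_irrefl_rels V" and "r \<in> V"
  defines "S \<equiv> G\<^sup>* `` {r}"
  shows "S \<subseteq> V" "r \<in> S" "G \<inter> S \<times> S \<in> connected_rels S"
    "G \<inter> (V - S) \<times> (V - S) \<in> sym_irrefl_rels (V - S)"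
    "G = G \<inter> S \<times> S \<union> G \<inter> (V - S) \<times> (V - S)"
proof -
  have sub: "G \<subseteq> V \<times> V" and sym: "sym G" and irr: "irrefl G"
    using G by (auto simp: sym_irrefl_rels_def)
  show "r \<in> S" by (simp add: S_def)
  have "v \<in> V" if "(r, v) \<in> G\<^sup>*" for v
    using that by induction (use sub \<open>r \<in> V\<close> in auto)
  then show "S \<subseteq> V" by (auto simp: S_def)
  have closed: "v \<in> S" if "(u, v) \<in> G" "u \<in> S" for u v
    using that by (auto simp: S_def)
  have closed': "u \<in> S" if "(u, v) \<in> G" "v \<in> S" for u v
    using closed[of v u] that sym by (auto dest: symD)
  show "G = G \<inter> S \<times> S \<union> G \<inter> (V - S) \<times> (V - S)"
    using sub closed closed' by auto
  show "G \<inter> (V - S) \<times> (V - S) \<in> sym_irrefl_rels (V - S)"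
    using sym irr by (auto simp: sym_irrefl_rels_def irrefl_def sym_def)
  let ?A = "G \<inter> S \<times> S"
  have A: "?A \<in> sym_irrefl_rels S"
    using sym irr by (auto simp: sym_irrefl_rels_def irrefl_def sym_def)
  \<comment> \<open>A path starting at \<open>r\<close> never leaves \<open>S\<close>, so all its
    edges survive the restriction.\<close>
  have reach: "(r, v) \<in> ?A\<^sup>*" if "(r, v) \<in> G\<^sup>*" for v
    using that
  proof induction
    case (step y z)
    then have "(y, z) \<in> ?A" using closed by (auto simp: S_def)
    with step.IH show ?case by (rule rtrancl_into_rtrancl)
  qed auto
  \<comment> \<open>By symmetry, any two nodes of \<open>S\<close> are joined by a path through
    \<open>r\<close>.\<close>
  have "sym (?A\<^sup>*)"
    using A by (intro sym_rtrancl) (auto simp: sym_irrefl_rels_def)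
  then have "(u, v) \<in> ?A\<^sup>*" if "u \<in> S" "v \<in> S" for u v
    using reach[of u] reach[of v] that by (auto simp: S_def dest: symD intro: rtrancl_trans)
  with A show "?A \<in> connected_rels S" by (auto simp: connected_rels_def)
qed

text \<open>Every graph is, in exactly one way, a connected graph on a set \<open>S\<close>
  containing \<open>r\<close> together with an arbitrary graph on \<open>V - S\<close>.\<close>

lemma card_sym_irrefl_rels_by_component:
  assumes "finite V" "r \<in> V"
  shows "card (sym_irrefl_rels V) =
    (\<Sum>S | S \<subseteq> V \<and> r \<in> S. card (connected_rels S) * card (sym_irrefl_rels (V - S)))"
proof -
  let ?I = "{S. S \<subseteq> V \<and> r \<in> S}"
  let ?U = "\<lambda>S. (\<lambda>(A, B). A \<union> B) ` (connected_rels S \<times> sym_irrefl_rels (V - S))"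
  have finS: "finite S" if "S \<in> ?I" for S
    using that assms finite_subset by auto
  have "sym_irrefl_rels V = (\<Union>S\<in>?I. ?U S)"
  proof
    show "sym_irrefl_rels V \<subseteq> (\<Union>S\<in>?I. ?U S)"
    proof
      fix G assume "G \<in> sym_irrefl_rels V"
      note * = split_off_component[OF this \<open>r \<in> V\<close>]
      show "G \<in> (\<Union>S\<in>?I. ?U S)"
        using *(1-4) by (intro UN_I[of "G\<^sup>* `` {r}"] image_eqI[OF _ SigmaI[OF *(3,4)]])
          (use *(5) in auto)
    qed
    show "(\<Union>S\<in>?I. ?U S) \<subseteq> sym_irrefl_rels V"
      by (auto simp: connected_rels_def sym_irrefl_rels_def irrefl_def sym_def; blast)
  qed
  moreover have "card (\<Union>S\<in>?I. ?U S) = (\<Sum>S\<in>?I. card (?U S))"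
  proof (rule card_UN_disjoint)
    show "finite ?I" using assms by simp
    show "\<forall>S\<in>?I. finite (?U S)"
      using finS assms by (auto intro!: finite_imageI finite_cartesian_product
          finite_connected_rels finite_sym_irrefl_rels)
    show "\<forall>S\<in>?I. \<forall>T\<in>?I. S \<noteq> T \<longrightarrow> ?U S \<inter> ?U T = {}"
    proof (intro ballI impI equals0I)
      fix S T G assume *: "S \<in> ?I" "T \<in> ?I" "S \<noteq> T" "G \<in> ?U S \<inter> ?U T"
      then obtain A B where "A \<in> connected_rels S" "B \<in> sym_irrefl_rels (V - S)" "G = A \<union> B"
        by (elim IntE imageE SigmaE) simp
      moreover from * obtain A' B'
        where "A' \<in> connected_rels T" "B' \<in> sym_irrefl_rels (V - T)" "G = A' \<union> B'"
        by (elim IntE imageE SigmaE) simp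
      ultimately have "G\<^sup>* `` {r} = S" "G\<^sup>* `` {r} = T"
        using component_of_union[of A S B V r] component_of_union[of A' T B' V r] *(1,2) by auto
      with * show False by simp
    qed
  qed
  moreover have "card (?U S) = card (connected_rels S) * card (sym_irrefl_rels (V - S))" for S
  proof -
    have "inj_on (\<lambda>(A, B). A \<union> B) (connected_rels S \<times> sym_irrefl_rels (V - S))"
    proof (rule inj_on_inverseI)
      fix p assume "p \<in> connected_rels S \<times> sym_irrefl_rels (V - S)"
      then obtain A B where "p = (A, B)" "A \<subseteq> S \<times> S" "B \<subseteq> (V - S) \<times> (V - S)"
        by (cases p) (simp add: connected_rels_def sym_irrefl_rels_def)
      moreover from this have "(A \<union> B) \<inter> S \<times> S = A" "(A \<union> B) - S \<times> S = B"
        by blast+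
      ultimately show "(\<lambda>G. (G \<inter> S \<times> S, G - S \<times> S)) ((\<lambda>(A, B). A \<union> B) p) = p"
        by simp
    qed
    then show ?thesis by (simp add: card_image card_cartesian_product)
  qed
  ultimately show ?thesis by simp
qed

lemma sum_Pow_card:
  fixes h :: "nat \<Rightarrow> nat"
  assumes "finite W"
  shows "(\<Sum>T\<in>Pow W. h (card T)) = (\<Sum>k\<le>card W. (card W choose k) * h k)"
proof -
  have "(\<Sum>T\<in>Pow W. h (card T)) = (\<Sum>k\<le>card W. \<Sum>T | T \<in> Pow W \<and> card T = k. h (card T))"
    by (rule sum.group[symmetric]) (use assms in \<open>auto intro: card_mono\<close>)
  also have "\<dots> = (\<Sum>k\<le>card W. (card W choose k) * h k)"
    using assms by (intro sum.cong) (auto simp: n_subsets)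
  finally show ?thesis .
qed

text \<open>The decomposition is applied to the nodes \<open>0, ..., n\<close> with root 0;
  \<open>k\<close> counts the other nodes in the root's component, which can be chosen in
  \<open>n choose k\<close> ways.\<close>

lemma connected_rels_recurrence:
  "2 ^ (Suc n choose 2) =
    (\<Sum>k\<le>n. (n choose k) * (card (connected_rels {1..Suc k}) * 2 ^ ((n - k) choose 2)))"
proof -
  let ?V = "{..n}" and ?W = "{1..n}"
  have V: "?V = insert 0 ?W" by auto
  have "2 ^ (Suc n choose 2) = card (sym_irrefl_rels ?V)"
    by (simp add: card_sym_irrefl_rels)
  also have "\<dots> = (\<Sum>S | S \<subseteq> ?V \<and> 0 \<in> S.
      card (connected_rels S) * card (sym_irrefl_rels (?V - S)))"
    by (rule card_sym_irrefl_rels_by_component) auto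
  also have "\<dots> = (\<Sum>T\<in>Pow ?W. card (connected_rels {1..Suc (card T)}) * 2 ^ ((n - card T) choose 2))"
  proof (rule sum.reindex_bij_witness[where i = "insert 0" and j = "\<lambda>S. S - {0}"])
    fix S assume S: "S \<in> {S. S \<subseteq> ?V \<and> 0 \<in> S}"
    then have fin: "finite S" using finite_subset by auto
    have c: "card S = Suc (card (S - {0}))"
      using S fin by (intro card.remove) auto
    \<comment> \<open>Only the number of nodes matters, so \<open>S\<close> may be replaced by an
      initial segment.\<close>
    have "card (connected_rels S) = card (connected_rels {1..Suc (card (S - {0}))})"
      using fin c by (intro card_connected_rels_cong) auto
    moreover have "card (?V - S) = n - card (S - {0})"
      using S fin c by (simp add: card_Diff_subset)
    ultimately show "card (connected_rels {1..Suc (card (S - {0}))}) * 2 ^ ((n - card (S - {0})) choose 2)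
        = card (connected_rels S) * card (sym_irrefl_rels (?V - S))"
      by (simp add: card_sym_irrefl_rels)
  qed (auto simp: Suc_le_eq)
  also have "\<dots> = (\<Sum>k\<le>n. (n choose k) * (card (connected_rels {1..Suc k}) * 2 ^ ((n - k) choose 2)))"
    using sum_Pow_card[of ?W "\<lambda>k. card (connected_rels {1..Suc k}) * 2 ^ ((n - k) choose 2)"]
    by simp
  finally show ?thesis .
qed

section \<open>From relations back to library graphs\<close>

text \<open>\<open>parcs\<close> is a bijection between the two encodings. The bound on
  \<open>N\<close> matters: the library's connectedness demands a node, whereas
  \<open>connected_rels {}\<close> contains the empty relation.\<close>

lemma num_connected_labeled_graphs_eq:
  assumes "N \<ge> 1"
  shows "num_connected_labeled_graphs N = card (connected_rels {1..N})"
proof -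
  have conn: "Digraph_Component.connected (with_proj G) \<longleftrightarrow> (\<forall>u\<in>pverts G. \<forall>v\<in>pverts G. (u, v) \<in> (parcs G)\<^sup>*)"
    if G: "parcs G \<in> sym_irrefl_rels (pverts G)" and "pverts G \<noteq> {}" for G :: "nat pair_pre_digraph"
  proof -
    have "(parcs (mk_symmetric (with_proj G))) = parcs G"
      using G by (auto simp: parcs_mk_symmetric sym_irrefl_rels_def dest: symD)
    \<comment> \<open>The library closure is reflexive only at vertices; since all arcs stay among
      the vertices, the closures agree from a vertex \<open>u\<close>.\<close>
    moreover have "(u, v) \<in> rtrancl_on (pverts G) (parcs G) \<longleftrightarrow> (u, v) \<in> (parcs G)\<^sup>*"
      if "u \<in> pverts G" for u v
    proof
      assume "(u, v) \<in> (parcs G)\<^sup>*"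
      then show "(u, v) \<in> rtrancl_on (pverts G) (parcs G)"
        by induction (use that G in \<open>auto simp: sym_irrefl_rels_def intro: rtrancl_on_into_rtrancl_on\<close>)
    qed (rule rtrancl_on_rtranclI)
    ultimately show ?thesis
      using that(2) by (simp add: Digraph_Component.connected_def strongly_connected_def reachable_def)
  qed
  have graph: "pair_graph G \<longleftrightarrow> parcs G \<in> sym_irrefl_rels (pverts G)"
    if "finite (pverts G)" for G :: "nat pair_pre_digraph"
  proof
    assume "pair_graph G"
    then interpret pair_graph G .
    show "parcs G \<in> sym_irrefl_rels (pverts G)"
      using pair_sym_arcs pair_no_loops[of "(a, a)" for a]
      by (auto simp: sym_irrefl_rels_def symmetric_def irrefl_def dest: in_arcsD1 in_arcsD2)
  next
    assume *: "parcs G \<in> sym_irrefl_rels (pverts G)"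
    then have "finite (parcs G)"
      using that finite_subset by (auto simp: sym_irrefl_rels_def)
    then show "pair_graph G"
      using * that by unfold_locales (auto simp: sym_irrefl_rels_def symmetric_def irrefl_def)
  qed
  have "bij_betw parcs (connected_labeled_graphs N) (connected_rels {1..N})"
  proof (rule bij_betw_byWitness[where f' = "\<lambda>R. \<lparr>pverts = {1..N}, parcs = R\<rparr>"])
    show "(\<lambda>R. \<lparr>pverts = {1..N}, parcs = R\<rparr>) ` connected_rels {1..N} \<subseteq> connected_labeled_graphs N"
      using assms by (auto simp: connected_labeled_graphs_def connected_rels_def graph conn)
    show "parcs ` connected_labeled_graphs N \<subseteq> connected_rels {1..N}"
    proof
      fix R assume "R \<in> parcs ` connected_labeled_graphs N"
      then obtain G where G: "R = parcs G" "pair_graph G" "pverts G = {1..N}"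
        "Digraph_Component.connected (with_proj G)"
        by (auto simp: connected_labeled_graphs_def)
      with graph[of G] conn[of G] assms show "R \<in> connected_rels {1..N}"
        by (auto simp: connected_rels_def)
    qed
  qed (auto simp: connected_labeled_graphs_def)
  then show ?thesis
    by (simp add: num_connected_labeled_graphs_def bij_betw_same_card)
qed

text \<open>The recurrence divided by \<open>n!\<close>: the binomial convolution becomes a product
  of series, and the left side becomes the coefficient of \<open>G(2z)\<close>.\<close>

lemma connected_egf:
  "fps_nth (Abs_fps (\<lambda>k. real (card (connected_rels {1..Suc k})) / fact k) * graph_egf) n
    = 2 ^ n * fps_nth graph_egf n"
proof -
  let ?C = "\<lambda>k. card (connected_rels {1..Suc k})"
  have "fps_nth (Abs_fps (\<lambda>k. real (?C k) / fact k) * graph_egf) n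
      = (\<Sum>k\<le>n. real (n choose k) * (real (?C k) * 2 ^ ((n - k) choose 2)) / fact n)"
    unfolding fps_mult_nth atLeast0AtMost
    by (intro sum.cong) (auto simp: graph_egf_def binomial_fact field_simps)
  also have "\<dots> = real (\<Sum>k\<le>n. (n choose k) * (?C k * 2 ^ ((n - k) choose 2))) / fact n"
    by (simp add: sum_divide_distrib)
  also have "\<dots> = 2 ^ (Suc n choose 2) / fact n"
    unfolding connected_rels_recurrence[symmetric] by simp
  also have "\<dots> = 2 ^ n * fps_nth graph_egf n"
    by (simp add: graph_egf_def numeral_2_eq_2 power_add)
  finally show ?thesis .
qed

theorem theorem1p2:
  fixes n :: nat
  assumes "n \<ge> 1"
  shows "measure (\<Pi>\<^sub>M i\<in>{1..n}. lborel) (cayley_polytope n) =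
           real (num_connected_labeled_graphs (n + 1)) / fact n"
proof -
  have "Abs_fps (\<lambda>k. chain_volume k 1) * graph_egf
      = Abs_fps (\<lambda>k. real (card (connected_rels {1..Suc k})) / fact k) * graph_egf"
    by (rule fps_ext) (simp only: chain_volume_one connected_egf)
  \<comment> \<open>Both series have the same product with \<open>G\<close>; real power series form
    an integral domain, so \<open>G\<close> cancels.\<close>
  moreover have "graph_egf \<noteq> 0"
    using graph_egf_nth_0 by auto
  ultimately have "Abs_fps (\<lambda>k. chain_volume k 1)
      = Abs_fps (\<lambda>k. real (card (connected_rels {1..Suc k})) / fact k)"
    by simp
  from arg_cong[OF this, of "\<lambda>F. fps_nth F n"]
  have "chain_volume n 1 = real (card (connected_rels {1..Suc n})) / fact n"
    by simp
  then show ?thesis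
    using measure_cayley_polytope[OF assms] num_connected_labeled_graphs_eq[of "n + 1"] by simp
qed

end
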